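(* Let $E$ be a set of meadow equations, i.e. equations over the signature $\Sigma_{\mathsf{Md}}$ of meadows. Then $$\mathbb{Q}_0 \cong \mathcal{I}(\Sigma_{\mathsf{Md}}, \mathsf{Md}+E) \quad\text{if and only if}\quad \text{for all prime numbers } p,\ (\mathbb{Z}/p\mathbb{Z})_0 \not\models E.$$
   Context: The signature $\Sigma_{\mathsf{Md}}$ of meadows has constants $0,1$, binary operations $+,\cdot$, and unary operations $-$ and ${}^{-1}$. The set $\mathsf{Md}$ of meadow axioms consists of the following equations (variables implicitly universally quantified): $(x+y)+z=x+(y+z)$; $x+y=y+x$; $x+0=x$; $x+(-x)=0$; $(x\cdot y)\cdot z=x\cdot(y\cdot z)$; $x\cdot y=y\cdot x$; $1\cdot x=x$; $x\cdot(y+z)=x\cdot y+x\cdot z$; $(x^{-1})^{-1}=x$; $x\cdot(x\cdot x^{-1})=x$. For a set $E$ of equations over $\Sigma_{\mathsf{Md}}$, $\mathcal{I}(\Sigma_{\mathsf{Md}},\mathsf{Md}+E)$ denotes the initial algebra of the equational theory $\mathsf{Md}\cup E$, i.e. the algebra of closed $\Sigma_{\mathsf{Md}}$-terms modulo equality provable from $\mathsf{Md}\cup E$; $\cong$ is isomorphism of $\Sigma_{\mathsf{Md}}$-algebras. The zero-totalized expansion of a field is the $\Sigma_{\mathsf{Md}}$-algebra obtained from the field by making the multiplicative inverse total via $0^{-1}=0$. $\mathbb{Q}_0$ is the zero-totalized expansion of the field of rational numbers, and $(\mathbb{Z}/p\mathbb{Z})_0$ is that of the prime field of order $p$. $A\models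 E$ means that every equation in $E$ holds in $A$ under all assignments of its variables; $A\not\models E$ means that at least one equation in $E$ fails in $A$ under some assignment.
   Formalization: The formal theorem adds the hypothesis that Md+E does not prove 0 = 1; without it the equivalence fails (e.g. E = {x = y} fails in every prime field, yet the initial algebra is trivial), and it fails for exactly the sets E excluded. *)

theory Defs
  imports "HOL-Algebra.Algebraic_Closure_Type" "HOL-Number_Theory.Residues"
begin

datatype md_term =
    Var nat
  | Zero
  | One
  | Add md_term md_term
  | Mul md_term md_term
  | Neg md_term
  | Inv md_term

primrec vars :: "md_term \<Rightarrow> nat set" where
  "vars (Var x) = {x}"
| "vars Zero = {}"
| "vars One = {}"
| "vars (Add s t) = vars s \<union> vars t"
| "vars (Mul s t) = vars s \<union> vars t"
| "vars (Neg t) = vars t"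
| "vars (Inv t) = vars t"

definition closed_terms :: "md_term set" where
  "closed_terms = {t. vars t = {}}"

primrec subst :: "(nat \<Rightarrow> md_term) \<Rightarrow> md_term \<Rightarrow> md_term" where
  "subst \<sigma> (Var x) = \<sigma> x"
| "subst \<sigma> Zero = Zero"
| "subst \<sigma> One = One"
| "subst \<sigma> (Add s t) = Add (subst \<sigma> s) (subst \<sigma> t)"
| "subst \<sigma> (Mul s t) = Mul (subst \<sigma> s) (subst \<sigma> t)"
| "subst \<sigma> (Neg t) = Neg (subst \<sigma> t)"
| "subst \<sigma> (Inv t) = Inv (subst \<sigma> t)"

text \<open>An equation \<open>s = t\<close> is represented by the pair \<open>(s, t)\<close>.\<close>

type_synonym md_eqn = "md_term \<times> md_term"

definition Md :: "md_eqn set" where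
  "Md = (let x = Var 0; y = Var 1; z = Var 2 in
    { (Add (Add x y) z, Add x (Add y z)),
      (Add x y, Add y x),
      (Add x Zero, x),
      (Add x (Neg x), Zero),
      (Mul (Mul x y) z, Mul x (Mul y z)),
      (Mul x y, Mul y x),
      (Mul One x, x),
      (Mul x (Add y z), Add (Mul x y) (Mul x z)),
      (Inv (Inv x), x),
      (Mul x (Mul x (Inv x)), x) })"

text \<open>Provability in equational logic.\<close>

inductive provable :: "md_eqn set \<Rightarrow> md_term \<Rightarrow> md_term \<Rightarrow> bool" for E :: "md_eqn set" where
  ax: "(s, t) \<in> E \<Longrightarrow> provable E (subst \<sigma> s) (subst \<sigma> t)"
| refl: "provable E t t"
| sym: "provable E s t \<Longrightarrow> provable E t s"
| trans: "provable E s t \<Longrightarrow> provable E t u \<Longrightarrow> provable E s u"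
| Add: "provable E s s' \<Longrightarrow> provable E t t' \<Longrightarrow> provable E (Add s t) (Add s' t')"
| Mul: "provable E s s' \<Longrightarrow> provable E t t' \<Longrightarrow> provable E (Mul s t) (Mul s' t')"
| Neg: "provable E t t' \<Longrightarrow> provable E (Neg t) (Neg t')"
| Inv: "provable E t t' \<Longrightarrow> provable E (Inv t) (Inv t')"

text \<open>
  Algebras over the signature of meadows extend the library's ring records. In such an algebra
  \<open>neg\<close> and \<open>minv\<close> are primitive operations, to be distinguished from the library's derived partial
  inverses \<open>a_inv\<close> and \<open>m_inv\<close>. The record itself imposes no axioms.
\<close>

record 'a md_algebra = "'a ring" +
  neg :: "'a \<Rightarrow> 'a"
  minv :: "'a \<Rightarrow> 'a"

primrec md_eval :: "('a, 'm) md_algebra_scheme \<Rightarrow> (nat \<Rightarrow> 'a) \<Rightarrow> md_term \<Rightarrow> 'a" where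
  "md_eval A v (Var x) = v x"
| "md_eval A v Zero = \<zero>\<^bsub>A\<^esub>"
| "md_eval A v One = \<one>\<^bsub>A\<^esub>"
| "md_eval A v (Add s t) = md_eval A v s \<oplus>\<^bsub>A\<^esub> md_eval A v t"
| "md_eval A v (Mul s t) = md_eval A v s \<otimes>\<^bsub>A\<^esub> md_eval A v t"
| "md_eval A v (Neg t) = neg A (md_eval A v t)"
| "md_eval A v (Inv t) = minv A (md_eval A v t)"

definition models :: "('a, 'm) md_algebra_scheme \<Rightarrow> md_eqn set \<Rightarrow> bool" where
  "models A E \<longleftrightarrow>
    (\<forall>(s, t) \<in> E. \<forall>v. (\<forall>x. v x \<in> carrier A) \<longrightarrow> md_eval A v s = md_eval A v t)"

definition md_iso ::
    "('a, 'm) md_algebra_scheme \<Rightarrow> ('b, 'n) md_algebra_scheme \<Rightarrow> ('a \<Rightarrow> 'b) set" where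
  "md_iso A B = {h. bij_betw h (carrier A) (carrier B) \<and>
     h \<zero>\<^bsub>A\<^esub> = \<zero>\<^bsub>B\<^esub> \<and> h \<one>\<^bsub>A\<^esub> = \<one>\<^bsub>B\<^esub> \<and>
     (\<forall>x\<in>carrier A. \<forall>y\<in>carrier A. h (x \<oplus>\<^bsub>A\<^esub> y) = h x \<oplus>\<^bsub>B\<^esub> h y) \<and>
     (\<forall>x\<in>carrier A. \<forall>y\<in>carrier A. h (x \<otimes>\<^bsub>A\<^esub> y) = h x \<otimes>\<^bsub>B\<^esub> h y) \<and>
     (\<forall>x\<in>carrier A. h (neg A x) = neg B (h x)) \<and>
     (\<forall>x\<in>carrier A. h (minv A x) = minv B (h x))}"

definition md_isomorphic ::
    "('a, 'm) md_algebra_scheme \<Rightarrow> ('b, 'n) md_algebra_scheme \<Rightarrow> bool" where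
  "md_isomorphic A B \<longleftrightarrow> md_iso A B \<noteq> {}"

definition closed_eq :: "md_eqn set \<Rightarrow> md_term rel" where
  "closed_eq E = {(s, t). s \<in> closed_terms \<and> t \<in> closed_terms \<and> provable E s t}"

text \<open>
  The term algebra construction of the initial algebra. The unions are over representatives of
  the classes; lemmas \<open>init_algebra_Add\<close> to \<open>init_algebra_Inv\<close> show that the operations do not
  depend on the choice of representatives.
\<close>

definition init_algebra :: "md_eqn set \<Rightarrow> md_term set md_algebra" where
  "init_algebra E =
    \<lparr> carrier = closed_terms // closed_eq E,
      monoid.mult = \<lambda>S T. \<Union>s\<in>S. \<Union>t\<in>T. closed_eq E `` {Mul s t},
      one = closed_eq E `` {One},
      zero = closed_eq E `` {Zero},
      add = \<lambda>S T. \<Union>s\<in>S. \<Union>t\<in>T. closed_eq E `` {Add s t},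
      neg = \<lambda>T. \<Union>t\<in>T. closed_eq E `` {Neg t},
      minv = \<lambda>T. \<Union>t\<in>T. closed_eq E `` {Inv t} \<rparr>"

definition zero_totalized :: "('a, 'm) ring_scheme \<Rightarrow> 'a md_algebra" where
  "zero_totalized F =
    \<lparr> carrier = carrier F,
      monoid.mult = monoid.mult F,
      one = one F,
      zero = zero F,
      add = add F,
      neg = \<lambda>x. \<ominus>\<^bsub>F\<^esub> x,
      minv = \<lambda>x. if x = \<zero>\<^bsub>F\<^esub> then \<zero>\<^bsub>F\<^esub> else inv\<^bsub>F\<^esub> x \<rparr>"

definition Q0 :: "rat md_algebra" where
  "Q0 = zero_totalized ring_of_type_algebra"

definition Zmod0 :: "nat \<Rightarrow> int md_algebra" where
  "Zmod0 p = zero_totalized (residue_ring (int p))"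

lemma equiv_closed_eq: "equiv closed_terms (closed_eq E)"
  by (rule equivI)
    (auto simp: closed_eq_def refl_on_def intro!: symI transI
      intro: provable.refl provable.sym provable.trans)

lemma init_algebra_Add:
  assumes "s \<in> closed_terms" "t \<in> closed_terms"
  shows "(closed_eq E `` {s}) \<oplus>\<^bsub>init_algebra E\<^esub> (closed_eq E `` {t}) = closed_eq E `` {Add s t}"
proof -
  have "congruent2 (closed_eq E) (closed_eq E) (\<lambda>s t. closed_eq E `` {Add s t})"
    unfolding congruent2_def
    by (auto intro!: equiv_class_eq[OF equiv_closed_eq])
      (auto simp: closed_eq_def closed_terms_def intro: provable.Add)
  from UN_equiv_class2[OF equiv_closed_eq equiv_closed_eq this assms] show ?thesis
    by (simp add: init_algebra_def)
qed

lemma init_algebra_Mul: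
  assumes "s \<in> closed_terms" "t \<in> closed_terms"
  shows "(closed_eq E `` {s}) \<otimes>\<^bsub>init_algebra E\<^esub> (closed_eq E `` {t}) = closed_eq E `` {Mul s t}"
proof -
  have "congruent2 (closed_eq E) (closed_eq E) (\<lambda>s t. closed_eq E `` {Mul s t})"
    unfolding congruent2_def
    by (auto intro!: equiv_class_eq[OF equiv_closed_eq])
      (auto simp: closed_eq_def closed_terms_def intro: provable.Mul)
  from UN_equiv_class2[OF equiv_closed_eq equiv_closed_eq this assms] show ?thesis
    by (simp add: init_algebra_def)
qed

lemma init_algebra_Neg:
  assumes "t \<in> closed_terms"
  shows "neg (init_algebra E) (closed_eq E `` {t}) = closed_eq E `` {Neg t}"
proof -
  have "congruent (closed_eq E) (\<lambda>t. closed_eq E `` {Neg t})"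
    unfolding congruent_def
    by (auto intro!: equiv_class_eq[OF equiv_closed_eq])
      (auto simp: closed_eq_def closed_terms_def intro: provable.Neg)
  from UN_equiv_class[OF equiv_closed_eq this assms] show ?thesis
    by (simp add: init_algebra_def)
qed

lemma init_algebra_Inv:
  assumes "t \<in> closed_terms"
  shows "minv (init_algebra E) (closed_eq E `` {t}) = closed_eq E `` {Inv t}"
proof -
  have "congruent (closed_eq E) (\<lambda>t. closed_eq E `` {Inv t})"
    unfolding congruent_def
    by (auto intro!: equiv_class_eq[OF equiv_closed_eq])
      (auto simp: closed_eq_def closed_terms_def intro: provable.Inv)
  from UN_equiv_class[OF equiv_closed_eq this assms] show ?thesis
    by (simp add: init_algebra_def)
qed

lemma Q0_simps:
  "carrier Q0 = UNIV" "\<zero>\<^bsub>Q0\<^esub> = 0" "\<one>\<^bsub>Q0\<^esub> = 1" "x \<oplus>\<^bsub>Q0\<^esub> y = x + y" "x \<otimes>\<^bsub>Q0\<^esub> y = x * y"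
  "neg Q0 x = - x" "minv Q0 x = inverse x"
proof -
  let ?R = "ring_of_type_algebra :: rat ring"
  interpret R: field ?R by (rule field_from_type_algebra)
  have R: "carrier ?R = UNIV" "\<zero>\<^bsub>?R\<^esub> = 0" "\<one>\<^bsub>?R\<^esub> = 1"
    "\<And>x y. x \<oplus>\<^bsub>?R\<^esub> y = x + y" "\<And>x y. x \<otimes>\<^bsub>?R\<^esub> y = x * y"
    by (simp_all add: ring_of_type_algebra_def)
  show "carrier Q0 = UNIV" "\<zero>\<^bsub>Q0\<^esub> = 0" "\<one>\<^bsub>Q0\<^esub> = 1" "x \<oplus>\<^bsub>Q0\<^esub> y = x + y"
    "x \<otimes>\<^bsub>Q0\<^esub> y = x * y"
    by (simp_all add: Q0_def zero_totalized_def R)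
  have "\<ominus>\<^bsub>?R\<^esub> x = - x"
    by (rule R.minus_equality) (simp_all add: R)
  then show "neg Q0 x = - x"
    by (simp add: Q0_def zero_totalized_def)
  have "inv\<^bsub>?R\<^esub> x = inverse x" if "x \<noteq> 0"
    by (rule R.comm_inv_char) (simp_all add: R that)
  then show "minv Q0 x = inverse x"
    by (simp add: Q0_def zero_totalized_def R)
qed

text \<open>
  Some consistency requirement on \<open>Md \<union> E\<close> is indispensable in a characterization of the \<open>E\<close>
  with \<open>Q0\<close> isomorphic to \<open>init_algebra (Md \<union> E)\<close> by failure of \<open>E\<close> in the finite prime fields:
  a set of equations that collapses all terms fails in every prime field, but the
  resulting initial algebra is trivial.
\<close>

lemma inconsistent_counterexample:
  defines "E \<equiv> {(Var 0, Var 1)}"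
  shows "\<forall>p. prime p \<longrightarrow> \<not> models (Zmod0 p) E"
    and "\<not> md_isomorphic Q0 (init_algebra (Md \<union> E))"
proof -
  show "\<forall>p. prime p \<longrightarrow> \<not> models (Zmod0 p) E"
  proof (intro allI impI notI)
    fix p :: nat
    assume p: "prime p" and m: "models (Zmod0 p) E"
    let ?v = "\<lambda>x::nat. if x = 0 then 0 else 1 :: int"
    have v: "\<forall>x. ?v x \<in> carrier (Zmod0 p)"
      using prime_gt_1_nat[OF p] by (auto simp: Zmod0_def zero_totalized_def residue_ring_def)
    have eq: "\<forall>v. (\<forall>x. v x \<in> carrier (Zmod0 p)) \<longrightarrow> v 0 = v (Suc 0)"
      using m by (simp add: models_def E_def)
    from mp[OF spec[OF eq, of ?v] v] show False by simp
  qed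
  show "\<not> md_isomorphic Q0 (init_algebra (Md \<union> E))"
  proof
    assume "md_isomorphic Q0 (init_algebra (Md \<union> E))"
    then obtain h where h: "h \<in> md_iso Q0 (init_algebra (Md \<union> E))"
      by (auto simp: md_isomorphic_def)
    have "provable (Md \<union> E) Zero One"
      using provable.ax[of "Var 0" "Var 1" "Md \<union> E" "\<lambda>x. if x = 0 then Zero else One"]
      by (simp add: E_def)
    then have "(Zero, One) \<in> closed_eq (Md \<union> E)"
      by (simp add: closed_eq_def closed_terms_def)
    then have "closed_eq (Md \<union> E) `` {Zero} = closed_eq (Md \<union> E) `` {One}"
      by (rule equiv_class_eq[OF equiv_closed_eq])
    then have "h 0 = h 1"
      using h by (simp add: md_iso_def init_algebra_def Q0_simps)
    moreover have "inj h"
      using h by (simp add: md_iso_def bij_betw_def Q0_simps)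
    ultimately show False
      by (auto dest: injD)
  qed
qed

end

theory Submission
  imports Defs
begin

text \<open>
  If \<open>Q0\<close> is isomorphic to the initial algebra, then \<open>p \<cdot> p\<inverse> = 1\<close>, being a closed equation true
  of the rational numbers, is provable from \<open>Md \<union> E\<close> for every prime \<open>p\<close>. The field of \<open>p\<close>
  elements violates this equation, since there \<open>p = 0\<close>; it satisfies \<open>Md\<close>, so by soundness it
  violates \<open>E\<close>.

  For the converse, let \<open>A\<close> be the initial algebra. In the meadow \<open>A\<close> the element
  \<open>e = 1 - p \<cdot> p\<inverse>\<close> is an idempotent with \<open>e \<cdot> p = 0\<close>, so \<open>n \<mapsto> e \<cdot> n\<close> maps the field of \<open>p\<close>
  elements into \<open>A\<close> and respects sums and products, while it sends \<open>1\<close> to \<open>e\<close>. The axioms of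
  meadows force such a map \<open>h\<close> to respect inverses up to the factor \<open>e\<close>, hence to carry the value
  of a term in the field to \<open>e\<close> times its value in \<open>A\<close> (lemma \<open>h_md_eval\<close>). If \<open>e \<noteq> 0\<close>, then \<open>h\<close> is
  injective and pulls the equations \<open>E\<close> back from \<open>A\<close> to the field (lemma \<open>models_reflected\<close>).
  Since \<open>E\<close> fails in the field, \<open>e = 0\<close>: every prime is invertible in \<open>A\<close>.

  Consequently every positive integer is invertible in \<open>A\<close>, and fractions give a map from the
  rational numbers to \<open>A\<close>. It respects sums, products and \<open>1\<close>, so lemma \<open>h_md_eval\<close> applies once
  more, now with \<open>e = 1\<close>: the map is a homomorphism of meadows, and it is surjective because every
  element of \<open>A\<close> is the value of a closed term. It is injective because \<open>0 \<noteq> 1\<close> in \<open>A\<close>, which is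
  the consistency of \<open>Md \<union> E\<close>.
\<close>

section \<open>Meadows as commutative rings\<close>

text \<open>
  The axioms \<open>Md\<close> are restated on top of the library's commutative rings, which makes the ring
  calculus applicable. Lemmas \<open>models_Md\<close> and \<open>meadow_if_models_Md\<close> show that the two
  presentations agree.
\<close>

locale meadow = cring A for A :: "('a, 'm) md_algebra_scheme" (structure) +
  assumes neg_eq: "x \<in> carrier A \<Longrightarrow> neg A x = \<ominus> x"
    and minv_closed [simp]: "x \<in> carrier A \<Longrightarrow> minv A x \<in> carrier A"
    and minv_minv: "x \<in> carrier A \<Longrightarrow> minv A (minv A x) = x"
    and m_m_minv: "x \<in> carrier A \<Longrightarrow> x \<otimes> (x \<otimes> minv A x) = x"
begin

lemma neg_closed [simp]: "x \<in> carrier A \<Longrightarrow> neg A x \<in> carrier A"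
  by (simp add: neg_eq)

lemma md_eval_closed: "(\<And>x. v x \<in> carrier A) \<Longrightarrow> md_eval A v t \<in> carrier A"
  by (induction t) auto

lemma models_Md: "models A Md"
  by (auto simp: models_def Md_def Let_def neg_eq minv_minv m_m_minv r_neg
      r_distr a_ac m_ac)

end

lemma md_eval_subst: "md_eval A v (subst \<sigma> t) = md_eval A (\<lambda>x. md_eval A v (\<sigma> x)) t"
  by (induction t) auto

lemma meadow_if_models_Md:
  fixes A :: "('a, 'm) md_algebra_scheme" (structure)
  assumes closed: "\<zero> \<in> carrier A" "\<one> \<in> carrier A"
      "\<And>x y. x \<in> carrier A \<Longrightarrow> y \<in> carrier A \<Longrightarrow> x \<oplus> y \<in> carrier A"
      "\<And>x y. x \<in> carrier A \<Longrightarrow> y \<in> carrier A \<Longrightarrow> x \<otimes> y \<in> carrier A"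
      "\<And>x. x \<in> carrier A \<Longrightarrow> neg A x \<in> carrier A"
      "\<And>x. x \<in> carrier A \<Longrightarrow> minv A x \<in> carrier A"
    and "models A Md"
  shows "meadow A"
proof -
  have Md_instance: "md_eval A (\<lambda>n. if n = 0 then x else if n = 1 then y else z) s
      = md_eval A (\<lambda>n. if n = 0 then x else if n = 1 then y else z) t"
    if "x \<in> carrier A" "y \<in> carrier A" "z \<in> carrier A" "(s, t) \<in> Md" for x y z s t
    using \<open>models A Md\<close> that unfolding models_def by fastforce
  note inst = Md_instance[unfolded Md_def Let_def]
  have a_assoc: "(x \<oplus> y) \<oplus> z = x \<oplus> (y \<oplus> z)"
    and m_assoc: "(x \<otimes> y) \<otimes> z = x \<otimes> (y \<otimes> z)"
    and distr: "x \<otimes> (y \<oplus> z) = x \<otimes> y \<oplus> x \<otimes> z"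
    if "x \<in> carrier A" "y \<in> carrier A" "z \<in> carrier A" for x y z
    using inst[OF that, of "Add (Add (Var 0) (Var 1)) (Var 2)"]
      inst[OF that, of "Mul (Mul (Var 0) (Var 1)) (Var 2)"]
      inst[OF that, of "Mul (Var 0) (Add (Var 1) (Var 2))"] by simp_all
  have a_comm: "x \<oplus> y = y \<oplus> x" and m_comm: "x \<otimes> y = y \<otimes> x"
    if "x \<in> carrier A" "y \<in> carrier A" for x y
    using inst[OF that closed(1), of "Add (Var 0) (Var 1)"]
      inst[OF that closed(1), of "Mul (Var 0) (Var 1)"] by simp_all
  have r_zero: "x \<oplus> \<zero> = x" and r_neg_md: "x \<oplus> neg A x = \<zero>" and l_one: "\<one> \<otimes> x = x"
    and minv: "minv A (minv A x) = x" "x \<otimes> (x \<otimes> minv A x) = x"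
    if "x \<in> carrier A" for x
    using inst[OF that closed(1) closed(1), of "Add (Var 0) Zero"]
      inst[OF that closed(1) closed(1), of "Add (Var 0) (Neg (Var 0))"]
      inst[OF that closed(1) closed(1), of "Mul One (Var 0)"]
      inst[OF that closed(1) closed(1), of "Inv (Inv (Var 0))"]
      inst[OF that closed(1) closed(1), of "Mul (Var 0) (Mul (Var 0) (Inv (Var 0)))"] by simp_all
  have "abelian_group A"
  proof (rule abelian_groupI)
    show "\<zero> \<oplus> x = x" if "x \<in> carrier A" for x
      using r_zero[OF that] a_comm[OF that closed(1)] by simp
    show "\<exists>y\<in>carrier A. y \<oplus> x = \<zero>" if "x \<in> carrier A" for x
      using r_neg_md[OF that] a_comm[OF that closed(5)[OF that]] closed(5)[OF that] by auto
  qed (use closed a_assoc a_comm in auto)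
  moreover have "comm_monoid A"
    by (rule comm_monoidI) (use closed m_assoc m_comm l_one in auto)
  moreover have "(x \<oplus> y) \<otimes> z = x \<otimes> z \<oplus> y \<otimes> z"
    if "x \<in> carrier A" "y \<in> carrier A" "z \<in> carrier A" for x y z
    using distr[of z x y] m_comm[of z "x \<oplus> y"] m_comm[of z x] m_comm[of z y] that closed(3)
    by simp
  ultimately have "cring A" by (rule cringI)
  then interpret cring A .
  have "neg A x = \<ominus> x" if "x \<in> carrier A" for x
    using minus_equality[of "neg A x" x] r_neg_md[OF that] a_comm closed(5) that by auto
  then show ?thesis
    by unfold_locales (use closed minv in auto)
qed

lemma (in meadow) soundness:
  assumes "models A T" "provable T s t" "\<And>x. v x \<in> carrier A"
  shows "md_eval A v s = md_eval A v t"
  using assms(2)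
proof induction
  case (ax s t \<sigma>)
  then show ?case
    using assms(1,3) unfolding md_eval_subst models_def by (auto simp: md_eval_closed)
qed auto

lemma md_iso_eval:
  assumes "meadow A" "h \<in> md_iso A B" "\<And>x. v x \<in> carrier A"
  shows "h (md_eval A v t) = md_eval B (\<lambda>x. h (v x)) t"
proof -
  interpret meadow A by fact
  show ?thesis
    by (induction t) (use assms(2,3) in \<open>auto simp: md_iso_def md_eval_closed\<close>)
qed

section \<open>Zero-totalized fields\<close>

lemma (in field) minv_zero_totalized:
  assumes "x \<in> carrier R" "x \<noteq> \<zero>"
  shows "minv (zero_totalized R) x \<in> carrier R" "minv (zero_totalized R) x \<noteq> \<zero>"
    "x \<otimes> minv (zero_totalized R) x = \<one>"
proof -
  have "x \<in> Units R" using assms by (simp add: field_Units)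
  then show "minv (zero_totalized R) x \<in> carrier R" "x \<otimes> minv (zero_totalized R) x = \<one>"
    using assms by (auto simp: zero_totalized_def)
  then show "minv (zero_totalized R) x \<noteq> \<zero>"
    using assms by auto
qed

lemma (in field) meadow_zero_totalized: "meadow (zero_totalized R)"
proof (rule meadow_if_models_Md)
  have closed: "minv (zero_totalized R) x \<in> carrier R" if "x \<in> carrier R" for x
    using minv_zero_totalized(1)[OF that] by (cases "x = \<zero>") (auto simp: zero_totalized_def)
  then show "minv (zero_totalized R) x \<in> carrier (zero_totalized R)"
    if "x \<in> carrier (zero_totalized R)" for x
    using that by (simp add: zero_totalized_def)
  have minv_zero: "minv (zero_totalized R) \<zero> = \<zero>"
    by (simp add: zero_totalized_def)
  have "minv (zero_totalized R) (minv (zero_totalized R) x) = x" if x: "x \<in> carrier R" for x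
  proof (cases "x = \<zero>")
    case False
    note y = minv_zero_totalized[OF x False]
    note z = minv_zero_totalized[OF y(1,2)]
    show ?thesis
      using inv_unique[OF y(3) z(3)] x y z m_comm by simp
  qed (simp add: minv_zero)
  moreover have "x \<otimes> (x \<otimes> minv (zero_totalized R) x) = x" if x: "x \<in> carrier R" for x
    by (cases "x = \<zero>") (use x minv_zero_totalized[OF x] minv_zero in auto)
  moreover have "carrier (zero_totalized R) = carrier R"
      "\<And>x y. x \<oplus>\<^bsub>zero_totalized R\<^esub> y = x \<oplus> y" "\<And>x y. x \<otimes>\<^bsub>zero_totalized R\<^esub> y = x \<otimes> y"
      "\<zero>\<^bsub>zero_totalized R\<^esub> = \<zero>" "\<one>\<^bsub>zero_totalized R\<^esub> = \<one>"
      "\<And>x. neg (zero_totalized R) x = \<ominus> x"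
    by (simp_all add: zero_totalized_def)
  ultimately show "models (zero_totalized R) Md"
    by (simp add: models_def Md_def Let_def r_neg r_distr a_ac m_ac)
qed (simp_all add: zero_totalized_def)

lemma meadow_Q0: "meadow Q0"
  unfolding Q0_def by (intro field.meadow_zero_totalized field_from_type_algebra)

lemma meadow_Zmod0:
  assumes "prime p"
  shows "meadow (Zmod0 p)"
proof -
  interpret residues_prime p "residue_ring (int p)"
    using assms by unfold_locales auto
  show ?thesis
    unfolding Zmod0_def by (intro field.meadow_zero_totalized is_field)
qed

section \<open>Field homomorphisms that need not preserve the unit\<close>

text \<open>
  Such a map is a ring homomorphism onto its image, whose unit is the idempotent \<open>h \<one>\<^bsub>F\<^esub>\<close>. The case
  of a unit different from \<open>\<one>\<close> arises for the component of a meadow that is annihilated by a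
  prime number.
\<close>

locale nonunital_field_hom = A: meadow A + F: field F
  for A :: "('a, 'm) md_algebra_scheme" (structure) and F :: "('b, 'n) ring_scheme" +
  fixes h :: "'b \<Rightarrow> 'a"
  assumes h_closed [simp]: "a \<in> carrier F \<Longrightarrow> h a \<in> carrier A"
    and h_add: "a \<in> carrier F \<Longrightarrow> b \<in> carrier F \<Longrightarrow> h (a \<oplus>\<^bsub>F\<^esub> b) = h a \<oplus> h b"
    and h_mult: "a \<in> carrier F \<Longrightarrow> b \<in> carrier F \<Longrightarrow> h (a \<otimes>\<^bsub>F\<^esub> b) = h a \<otimes> h b"
begin

lemma h_zero: "h \<zero>\<^bsub>F\<^esub> = \<zero>"
  using h_add[of "\<zero>\<^bsub>F\<^esub>" "\<zero>\<^bsub>F\<^esub>"] A.add.l_cancel_one[of "h \<zero>\<^bsub>F\<^esub>" "h \<zero>\<^bsub>F\<^esub>"] by simp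

lemma h_neg: "a \<in> carrier F \<Longrightarrow> h (\<ominus>\<^bsub>F\<^esub> a) = \<ominus> h a"
  using h_add[of "\<ominus>\<^bsub>F\<^esub> a" a] A.minus_equality[of "h (\<ominus>\<^bsub>F\<^esub> a)" "h a"]
  by (simp add: h_zero F.l_neg)

text \<open>
  Inverses in \<open>A\<close> and in \<open>F\<close> are compatible because an inverse in the sense of meadows has the same
  annihilators as the element itself: where \<open>x\<close> becomes \<open>\<zero>\<close> after multiplication with \<open>h \<one>\<^bsub>F\<^esub>\<close>, so
  does its inverse, in accordance with \<open>0\<inverse> = 0\<close>; elsewhere the inverse is determined by \<open>x\<close>.
\<close>

lemma h_minv:
  assumes a: "a \<in> carrier F" and x: "x \<in> carrier A" and eq: "h a = h \<one>\<^bsub>F\<^esub> \<otimes> x"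
  shows "h (minv (zero_totalized F) a) = h \<one>\<^bsub>F\<^esub> \<otimes> minv A x"
proof -
  let ?e = "h \<one>\<^bsub>F\<^esub>" and ?y = "minv A x"
  have y: "?y \<in> carrier A" using x by simp
  show ?thesis
  proof (cases "a = \<zero>\<^bsub>F\<^esub>")
    case True
    \<comment> \<open>Since \<open>x\<close> is in turn the inverse of \<open>?y\<close>, the axiom \<open>m_m_minv\<close> makes \<open>?y\<close> a multiple of \<open>x\<close>.\<close>
    have "?e \<otimes> ?y = ?e \<otimes> (?y \<otimes> (?y \<otimes> x))"
      using A.m_m_minv[OF y] x by (simp add: A.minv_minv)
    also have "\<dots> = (?y \<otimes> ?y) \<otimes> (?e \<otimes> x)"
      using x y by (simp add: A.m_ac)
    also have "\<dots> = \<zero>"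
      using eq y by (simp add: True h_zero flip: eq)
    finally show ?thesis
      by (simp add: True zero_totalized_def h_zero)
  next
    case False
    define b where "b = minv (zero_totalized F) a"
    have b: "b \<in> carrier F" "a \<otimes>\<^bsub>F\<^esub> b = \<one>\<^bsub>F\<^esub>"
      using F.minv_zero_totalized[OF a False] by (simp_all add: b_def)
    have be: "h b \<otimes> ?e = h b"
      using h_mult[of b "\<one>\<^bsub>F\<^esub>"] b by simp
    have bx: "h b \<otimes> x = ?e"
    proof -
      have "?e = h a \<otimes> h b" using h_mult[OF a b(1)] b(2) by simp
      also have "\<dots> = (h b \<otimes> ?e) \<otimes> x" using x b by (simp add: eq A.m_ac)
      finally show ?thesis by (simp add: be)
    qed
    \<comment> \<open>The idempotent \<open>x \<otimes> minv A x\<close> absorbs \<open>x\<close>, hence also the multiple \<open>h \<one>\<^bsub>F\<^esub>\<close> of \<open>x\<close>.\<close>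
    have e_absorbs: "?e \<otimes> (x \<otimes> ?y) = ?e"
    proof -
      have "?e \<otimes> (x \<otimes> ?y) = h b \<otimes> (x \<otimes> (x \<otimes> ?y))"
        unfolding bx[symmetric] using x y b by (simp add: A.m_assoc)
      then show ?thesis using x by (simp add: A.m_m_minv bx)
    qed
    have "h b = h b \<otimes> (?e \<otimes> (x \<otimes> ?y))" by (simp add: e_absorbs be)
    also have "\<dots> = (h b \<otimes> ?e) \<otimes> x \<otimes> ?y" using x y b by (simp add: A.m_assoc)
    also have "\<dots> = ?e \<otimes> ?y" by (simp add: be bx)
    finally show ?thesis by (simp add: b_def)
  qed
qed

text \<open>
  The factor \<open>h \<one>\<^bsub>F\<^esub>\<close> projects to the component of \<open>A\<close> that contains the image of \<open>h\<close>. The values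
  of variables lie in that component, but the value of \<open>One\<close> in \<open>A\<close> may lie outside it.
\<close>

lemma h_md_eval:
  assumes v: "\<And>x. v x \<in> carrier F"
  shows "h (md_eval (zero_totalized F) v t) = h \<one>\<^bsub>F\<^esub> \<otimes> md_eval A (\<lambda>x. h (v x)) t"
proof -
  let ?e = "h \<one>\<^bsub>F\<^esub>" and ?F = "zero_totalized F"
  interpret ZF: meadow ?F by (rule F.meadow_zero_totalized)
  have F: "carrier ?F = carrier F" "\<zero>\<^bsub>?F\<^esub> = \<zero>\<^bsub>F\<^esub>" "\<one>\<^bsub>?F\<^esub> = \<one>\<^bsub>F\<^esub>"
      "\<And>a b. a \<oplus>\<^bsub>?F\<^esub> b = a \<oplus>\<^bsub>F\<^esub> b" "\<And>a b. a \<otimes>\<^bsub>?F\<^esub> b = a \<otimes>\<^bsub>F\<^esub> b" "\<And>a. neg ?F a = \<ominus>\<^bsub>F\<^esub> a"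
    by (simp_all add: zero_totalized_def)
  have eF: "md_eval ?F v t \<in> carrier F" for t
    using ZF.md_eval_closed[of v t] v by (simp add: F)
  have eA: "md_eval A (\<lambda>x. h (v x)) t \<in> carrier A" for t
    by (rule A.md_eval_closed) (simp add: v)
  have ee: "?e \<otimes> ?e = ?e"
    using h_mult[of "\<one>\<^bsub>F\<^esub>" "\<one>\<^bsub>F\<^esub>"] by simp
  show ?thesis
  proof (induction t)
    case (Var x)
    then show ?case using h_mult[of "\<one>\<^bsub>F\<^esub>" "v x"] v by simp
  next
    case (Mul s t)
    let ?s = "md_eval A (\<lambda>x. h (v x)) s" and ?t = "md_eval A (\<lambda>x. h (v x)) t"
    have "(?e \<otimes> ?s) \<otimes> (?e \<otimes> ?t) = (?e \<otimes> ?e) \<otimes> (?s \<otimes> ?t)"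
      by (simp add: A.m_ac eA del: ee)
    then show ?case using Mul by (simp add: F h_mult eF ee)
  qed (simp_all add: F h_zero h_add h_neg eF eA A.r_distr A.neg_eq A.r_minus h_minv)
qed

text \<open>
  A field has no nonzero proper ideals, so \<open>h\<close> is injective as soon as it does not vanish at \<open>\<one>\<^bsub>F\<^esub>\<close>, and an
  equation between values in \<open>A\<close> can be pulled back to \<open>F\<close>.
\<close>

lemma models_reflected:
  assumes "models A E" "h \<one>\<^bsub>F\<^esub> \<noteq> \<zero>"
  shows "models (zero_totalized F) E"
proof -
  interpret ZF: meadow "zero_totalized F" by (rule F.meadow_zero_totalized)
  have carrier: "carrier (zero_totalized F) = carrier F"
    by (simp add: zero_totalized_def)
  have inj: "a = b" if ab: "a \<in> carrier F" "b \<in> carrier F" "h a = h b" for a b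
  proof (rule ccontr)
    assume "a \<noteq> b"
    define d where "d = a \<oplus>\<^bsub>F\<^esub> \<ominus>\<^bsub>F\<^esub> b"
    have d: "d \<in> carrier F" "d \<noteq> \<zero>\<^bsub>F\<^esub>"
      using ab \<open>a \<noteq> b\<close> F.r_right_minus_eq[of a b] by (auto simp: d_def a_minus_def)
    have hd: "h d = \<zero>"
      using ab by (simp add: d_def h_add h_neg A.r_neg)
    note d' = F.minv_zero_totalized[OF d]
    have "h \<one>\<^bsub>F\<^esub> = h d \<otimes> h (minv (zero_totalized F) d)"
      using h_mult[OF d(1) d'(1)] d'(3) by simp
    then show False using hd d' assms(2) by simp
  qed
  show ?thesis
    unfolding models_def
  proof (clarify)
    fix s t and v :: "nat \<Rightarrow> 'b"
    assume st: "(s, t) \<in> E" and v: "\<forall>x. v x \<in> carrier (zero_totalized F)"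
    have "md_eval A (\<lambda>x. h (v x)) s = md_eval A (\<lambda>x. h (v x)) t"
      using assms(1) st v unfolding models_def by (fastforce simp: carrier)
    then show "md_eval (zero_totalized F) v s = md_eval (zero_totalized F) v t"
      using v by (intro inj) (auto simp: h_md_eval carrier ZF.md_eval_closed[unfolded carrier])
  qed
qed

end

section \<open>Invertibility of the integers\<close>

context meadow
begin

definition emb :: "int \<Rightarrow> 'a" where "emb n = [n] \<cdot> \<one>"

lemma emb_closed [simp]: "emb n \<in> carrier A"
  by (simp add: emb_def)

lemma emb_add: "emb (m + n) = emb m \<oplus> emb n"
  by (simp add: emb_def add.int_pow_mult)

lemma emb_mult: "emb (m * n) = emb m \<otimes> emb n"
  by (simp add: emb_def add_pow_ldistr_int add.int_pow_pow mult.commute)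

lemma emb_1: "emb 1 = \<one>"
  by (simp add: emb_def add.int_pow_1)

text \<open>
  The failure of \<open>E\<close> modulo \<open>p\<close> means that no nontrivial component of \<open>A\<close> can have
  characteristic \<open>p\<close>. The idempotent \<open>e\<close> of the proof projects to the largest component on which
  \<open>p\<close> vanishes; that component contains an image of the prime field, unless it is trivial.
\<close>

lemma prime_invertible:
  assumes p: "prime p" and E: "models A E" "\<not> models (Zmod0 p) E"
  shows "emb (int p) \<in> Units A"
proof -
  interpret P: residues_prime p "residue_ring (int p)"
    using p by unfold_locales auto
  let ?p = "emb (int p)" and ?F = "residue_ring (int p)"
  define e where "e = \<one> \<ominus> ?p \<otimes> minv A ?p"
  have e: "e \<in> carrier A" by (simp add: e_def)
  have ep: "e \<otimes> ?p = \<zero>"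
  proof -
    have "(?p \<otimes> minv A ?p) \<otimes> ?p = ?p" using m_m_minv[of ?p] by (simp add: m_ac)
    then show ?thesis by (simp add: e_def a_minus_def l_distr l_minus r_neg)
  qed
  have ee: "e \<otimes> e = e"
  proof -
    have "e \<otimes> (?p \<otimes> minv A ?p) = \<zero>" using ep e by (simp flip: m_assoc)
    moreover have "e \<otimes> e = e \<otimes> (\<one> \<ominus> ?p \<otimes> minv A ?p)" by (simp add: e_def)
    ultimately show ?thesis using e by (simp add: a_minus_def r_distr r_minus)
  qed
  define h where "h a = e \<otimes> emb a" for a
  have h_mod: "h (a mod int p) = h a" for a
  proof -
    have "h a = e \<otimes> emb (int p * (a div int p) + a mod int p)" by (simp add: h_def)
    also have "\<dots> = (e \<otimes> ?p) \<otimes> emb (a div int p) \<oplus> h (a mod int p)"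
      unfolding emb_add emb_mult h_def using e by (simp add: r_distr m_assoc)
    finally show ?thesis by (simp add: ep h_def e)
  qed
  interpret H: nonunital_field_hom A ?F h
  proof
    show "h a \<in> carrier A" for a by (simp add: h_def e)
    show "h (a \<oplus>\<^bsub>?F\<^esub> b) = h a \<oplus> h b" for a b
      unfolding P.res_add_eq h_mod by (simp add: h_def emb_add e r_distr)
    show "h (a \<otimes>\<^bsub>?F\<^esub> b) = h a \<otimes> h b" for a b
    proof -
      have "h a \<otimes> h b = (e \<otimes> e) \<otimes> (emb a \<otimes> emb b)" by (simp add: h_def e m_ac)
      then show ?thesis unfolding P.res_mult_eq h_mod by (simp add: h_def emb_mult ee)
    qed
  qed
  have "h \<one>\<^bsub>?F\<^esub> = e"
    by (simp add: P.res_one_eq h_mod) (simp add: h_def emb_1 e)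
  then have "e = \<zero>"
    using H.models_reflected[OF E(1)] E(2) by (auto simp: Zmod0_def)
  then have "?p \<otimes> minv A ?p = \<one>"
    by (simp add: e_def)
  then show ?thesis
    unfolding Units_def using m_comm[of ?p "minv A ?p"] by auto
qed

lemma positive_invertible:
  assumes "\<And>p. prime p \<Longrightarrow> emb (int p) \<in> Units A" and "n > 0"
  shows "emb (int n) \<in> Units A"
  using \<open>n > 0\<close>
proof (induction n rule: less_induct)
  case (less n)
  show ?case
  proof (cases "n = 1")
    case True
    then show ?thesis by (simp add: emb_1)
  next
    case False
    then obtain p k where p: "prime p" "n = p * k"
      using prime_factor_nat[of n] by (auto elim: dvdE)
    with less.prems have "0 < k" "k < n"
      using prime_gt_1_nat[OF p(1)] by auto
    then show ?thesis
      using less.IH[of k] assms(1)[OF p(1)] by (simp add: p(2) emb_mult)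
  qed
qed

section \<open>The rationals inside a meadow with invertible integers\<close>

definition rat_emb :: "rat \<Rightarrow> 'a" where
  "rat_emb q = emb (fst (quotient_of q)) \<otimes> inv (emb (snd (quotient_of q)))"

context
  assumes inv_emb: "\<And>n. n > 0 \<Longrightarrow> emb n \<in> Units A"
begin

lemma rat_emb_closed: "rat_emb q \<in> carrier A"
  using inv_emb quotient_of_denom_pos[of q "fst (quotient_of q)" "snd (quotient_of q)"]
  by (simp add: rat_emb_def)

lemma emb_mult_rat_emb:
  assumes "b > 0" "of_int b * q = of_int a"
  shows "emb b \<otimes> rat_emb q = emb a"
proof -
  obtain c d where cd: "quotient_of q = (c, d)" by (cases "quotient_of q")
  then have d: "d > 0" "q = of_int c / of_int d"
    by (auto simp: quotient_of_denom_pos quotient_of_div)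
  have "of_int (b * c) = (of_int (d * a) :: rat)"
    using assms(2) d by (simp add: field_simps)
  then have "b * c = d * a" by (simp only: of_int_eq_iff)
  then have "emb b \<otimes> emb c = emb d \<otimes> emb a"
    by (simp flip: emb_mult)
  moreover have "emb b \<otimes> rat_emb q = (emb b \<otimes> emb c) \<otimes> inv (emb d)"
    using inv_emb[OF d(1)] by (simp add: rat_emb_def cd m_assoc)
  ultimately have "emb b \<otimes> rat_emb q = (emb d \<otimes> inv (emb d)) \<otimes> emb a"
    using inv_emb[OF d(1)] by (simp add: m_ac)
  then show ?thesis
    using inv_emb[OF d(1)] by simp
qed

text \<open>
  Any representation of \<open>q\<close> as a fraction determines \<open>rat_emb q\<close>. This reduces the laws for sums and
  products to calculations with a common denominator.
\<close>

lemma rat_emb_unique: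
  assumes "b > 0" "of_int b * q = of_int a" "y \<in> carrier A" "emb b \<otimes> y = emb a"
  shows "rat_emb q = y"
  using Units_l_cancel[OF inv_emb[OF assms(1)] rat_emb_closed assms(3)]
    emb_mult_rat_emb[OF assms(1,2)] assms(4) by simp

lemma rat_emb_1: "rat_emb 1 = \<one>"
  by (rule rat_emb_unique[of 1 _ 1]) (simp_all add: emb_1)

lemma nonunital_field_hom_rat_emb: "nonunital_field_hom A ring_of_type_algebra rat_emb"
proof -
  let ?R = "ring_of_type_algebra :: rat ring"
  interpret R: field ?R by (rule field_from_type_algebra)
  show ?thesis
  proof
    show "rat_emb q \<in> carrier A" for q by (rule rat_emb_closed)
    fix q r :: rat
    obtain a b where q: "b > 0" "of_int b * q = of_int a"
      by (cases q) (auto simp: Fract_of_int_quotient)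
    obtain c d where r: "d > 0" "of_int d * r = of_int c"
      by (cases r) (auto simp: Fract_of_int_quotient)
    note Q = emb_mult_rat_emb[OF q] and R = emb_mult_rat_emb[OF r]
    have "rat_emb (q + r) = rat_emb q \<oplus> rat_emb r"
    proof (rule rat_emb_unique)
      show "b * d > 0" using q r by simp
      have "of_int (b * d) * (q + r) = of_int d * (of_int b * q) + of_int b * (of_int d * r)"
        by (simp add: algebra_simps)
      then show "of_int (b * d) * (q + r) = of_int (d * a + b * c)" using q r by simp
      have "emb (b * d) \<otimes> (rat_emb q \<oplus> rat_emb r)
          = emb d \<otimes> (emb b \<otimes> rat_emb q) \<oplus> emb b \<otimes> (emb d \<otimes> rat_emb r)"
        by (simp add: emb_mult rat_emb_closed r_distr m_ac)
      then show "emb (b * d) \<otimes> (rat_emb q \<oplus> rat_emb r) = emb (d * a + b * c)"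
        by (simp add: Q R emb_add emb_mult)
    qed (simp add: rat_emb_closed)
    then show "rat_emb (q \<oplus>\<^bsub>?R\<^esub> r) = rat_emb q \<oplus> rat_emb r"
      by (simp add: ring_of_type_algebra_def)
    have "rat_emb (q * r) = rat_emb q \<otimes> rat_emb r"
    proof (rule rat_emb_unique)
      show "b * d > 0" using q r by simp
      have "of_int (b * d) * (q * r) = (of_int b * q) * (of_int d * r)" by simp
      then show "of_int (b * d) * (q * r) = of_int (a * c)" using q r by simp
      have "emb (b * d) \<otimes> (rat_emb q \<otimes> rat_emb r)
          = (emb b \<otimes> rat_emb q) \<otimes> (emb d \<otimes> rat_emb r)"
        by (simp add: emb_mult rat_emb_closed m_ac)
      then show "emb (b * d) \<otimes> (rat_emb q \<otimes> rat_emb r) = emb (a * c)"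
        by (simp add: Q R emb_mult)
    qed (simp add: rat_emb_closed)
    then show "rat_emb (q \<otimes>\<^bsub>?R\<^esub> r) = rat_emb q \<otimes> rat_emb r"
      by (simp add: ring_of_type_algebra_def)
  qed
qed

lemma rat_emb_md_eval: "rat_emb (md_eval Q0 v t) = md_eval A (\<lambda>x. rat_emb (v x)) t"
proof -
  interpret H: nonunital_field_hom A "ring_of_type_algebra :: rat ring" rat_emb
    by (rule nonunital_field_hom_rat_emb)
  have "md_eval A (\<lambda>x. rat_emb (v x)) t \<in> carrier A"
    by (intro md_eval_closed rat_emb_closed)
  then show ?thesis
    using H.h_md_eval[of v t] rat_emb_1 by (simp add: Q0_def ring_of_type_algebra_def)
qed

text \<open>
  If \<open>q \<noteq> r\<close>, then \<open>q - r\<close> is invertible, so a coincidence of the images of \<open>q\<close> and \<open>r\<close> would make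
  the image of \<open>1\<close> vanish.
\<close>

lemma inj_rat_emb:
  assumes "\<one> \<noteq> \<zero>"
  shows "inj rat_emb"
proof (rule injI)
  fix q r assume eq: "rat_emb q = rat_emb r"
  let ?d = "Add (Var 0) (Neg (Var 1))" and ?v = "\<lambda>n::nat. if n = 0 then q else r"
  have "rat_emb (q - r) = \<zero>"
    using rat_emb_md_eval[of ?v ?d] rat_emb_closed[of r]
    by (simp add: Q0_simps eq neg_eq r_neg)
  then have "rat_emb ((q - r) * inverse (q - r)) = \<zero>"
    using rat_emb_md_eval[of "\<lambda>_. q - r" "Mul (Var 0) (Inv (Var 0))"]
    by (simp add: Q0_simps)
  then show "q = r"
    using assms by (cases "q = r") (auto simp: rat_emb_1)
qed

text \<open>
  The assumption \<open>minimal\<close> says that \<open>A\<close> is generated by its constants: the quantifier over all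
  \<open>v\<close> means that the variables of \<open>t\<close> do not influence its value.
\<close>

lemma Q0_isomorphic:
  assumes "\<one> \<noteq> \<zero>"
    and minimal: "\<And>x. x \<in> carrier A \<Longrightarrow> \<exists>t. \<forall>v. md_eval A v t = x"
  shows "md_isomorphic Q0 A"
proof -
  have "bij_betw rat_emb (carrier Q0) (carrier A)"
    unfolding bij_betw_def
  proof
    show "inj_on rat_emb (carrier Q0)"
      using inj_rat_emb[OF assms(1)] by (simp add: Q0_simps)
    have "x \<in> range rat_emb" if x: "x \<in> carrier A" for x
    proof -
      obtain t where "\<forall>v. md_eval A v t = x" using minimal[OF x] by blast
      then have "rat_emb (md_eval Q0 (\<lambda>_. 0) t) = x"
        by (simp add: rat_emb_md_eval)
      then show ?thesis by blast
    qed
    then show "rat_emb ` carrier Q0 = carrier A"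
      by (auto simp: Q0_simps rat_emb_closed)
  qed
  moreover have "rat_emb 0 = \<zero>"
    using rat_emb_md_eval[of _ Zero] by (simp add: Q0_simps)
  moreover have "rat_emb (q + r) = rat_emb q \<oplus> rat_emb r"
      "rat_emb (q * r) = rat_emb q \<otimes> rat_emb r" for q r
    using rat_emb_md_eval[of "\<lambda>n. if n = 0 then q else r" "Add (Var 0) (Var 1)"]
      rat_emb_md_eval[of "\<lambda>n. if n = 0 then q else r" "Mul (Var 0) (Var 1)"]
    by (simp_all add: Q0_simps)
  moreover have "rat_emb (- q) = neg A (rat_emb q)" "rat_emb (inverse q) = minv A (rat_emb q)" for q
    using rat_emb_md_eval[of "\<lambda>_. q" "Neg (Var 0)"] rat_emb_md_eval[of "\<lambda>_. q" "Inv (Var 0)"]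
    by (simp_all add: Q0_simps)
  ultimately have "rat_emb \<in> md_iso Q0 A"
    by (simp add: md_iso_def Q0_simps rat_emb_1)
  then show ?thesis by (auto simp: md_isomorphic_def)
qed

end

end

section \<open>The initial algebra\<close>

lemma init_algebra_carrier_iff:
  "c \<in> carrier (init_algebra T) \<longleftrightarrow> (\<exists>t\<in>closed_terms. c = closed_eq T `` {t})"
  by (auto simp: init_algebra_def quotient_def)

lemma init_algebra_class_in_carrier:
  "t \<in> closed_terms \<Longrightarrow> closed_eq T `` {t} \<in> carrier (init_algebra T)"
  by (auto simp: init_algebra_carrier_iff)

lemma init_algebra_class_eq_iff:
  assumes "s \<in> closed_terms" "t \<in> closed_terms"
  shows "closed_eq T `` {s} = closed_eq T `` {t} \<longleftrightarrow> provable T s t"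
  using eq_equiv_class_iff[OF equiv_closed_eq assms] assms by (simp add: closed_eq_def)

lemma init_algebra_eval_subst:
  assumes "\<And>x. \<sigma> x \<in> closed_terms"
  shows "md_eval (init_algebra T) (\<lambda>x. closed_eq T `` {\<sigma> x}) t = closed_eq T `` {subst \<sigma> t}"
proof -
  have "subst \<sigma> t \<in> closed_terms" for t
    by (induction t) (use assms in \<open>auto simp: closed_terms_def\<close>)
  then show ?thesis
    by (induction t)
      (simp_all add: init_algebra_Add init_algebra_Mul init_algebra_Neg init_algebra_Inv,
       simp_all add: init_algebra_def)
qed

lemma init_algebra_eval_closed:
  assumes "t \<in> closed_terms"
  shows "md_eval (init_algebra T) v t = closed_eq T `` {t}"
  using assms
  by (induction t)
    (auto simp: closed_terms_def init_algebra_Add init_algebra_Mul init_algebra_Neg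
      init_algebra_Inv, simp_all add: init_algebra_def)

lemma init_algebra_models: "models (init_algebra T) T"
  unfolding models_def
proof clarify
  fix s t and v :: "nat \<Rightarrow> md_term set"
  assume st: "(s, t) \<in> T" and "\<forall>x. v x \<in> carrier (init_algebra T)"
  then obtain \<sigma> :: "nat \<Rightarrow> md_term" where \<sigma>: "\<And>x. \<sigma> x \<in> closed_terms" "\<And>x. v x = closed_eq T `` {\<sigma> x}"
    unfolding init_algebra_carrier_iff by metis
  \<comment> \<open>Choosing representatives turns an assignment into a closed substitution, and the equation into
    an instance of an axiom.\<close>
  have v: "v = (\<lambda>x. closed_eq T `` {\<sigma> x})" using \<sigma>(2) by blast
  have closed: "subst \<sigma> t \<in> closed_terms" for t
    by (induction t) (use \<sigma>(1) in \<open>auto simp: closed_terms_def\<close>)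
  show "md_eval (init_algebra T) v s = md_eval (init_algebra T) v t"
    unfolding v init_algebra_eval_subst[OF \<sigma>(1)] init_algebra_class_eq_iff[OF closed closed]
    using st by (rule provable.ax)
qed

lemma meadow_init_algebra:
  assumes "Md \<subseteq> T"
  shows "meadow (init_algebra T)"
proof (rule meadow_if_models_Md)
  show "models (init_algebra T) Md"
    using init_algebra_models[of T] assms unfolding models_def by blast
  from init_algebra_class_in_carrier[of Zero] init_algebra_class_in_carrier[of One]
  show "\<zero>\<^bsub>init_algebra T\<^esub> \<in> carrier (init_algebra T)" "\<one>\<^bsub>init_algebra T\<^esub> \<in> carrier (init_algebra T)"
    by (simp_all add: closed_terms_def) (simp_all add: init_algebra_def)
  have closed_terms: "Add s t \<in> closed_terms" "Mul s t \<in> closed_terms"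
    if "s \<in> closed_terms" "t \<in> closed_terms" for s t
    using that by (simp_all add: closed_terms_def)
  fix x y
  assume "x \<in> carrier (init_algebra T)" "y \<in> carrier (init_algebra T)"
  then obtain s t where st: "s \<in> closed_terms" "t \<in> closed_terms"
      "x = closed_eq T `` {s}" "y = closed_eq T `` {t}"
    unfolding init_algebra_carrier_iff by blast
  from st(1,2) show "x \<oplus>\<^bsub>init_algebra T\<^esub> y \<in> carrier (init_algebra T)"
      "x \<otimes>\<^bsub>init_algebra T\<^esub> y \<in> carrier (init_algebra T)"
    by (simp_all add: st init_algebra_Add init_algebra_Mul init_algebra_class_in_carrier closed_terms)
next
  fix x
  assume "x \<in> carrier (init_algebra T)"
  then obtain t where t: "t \<in> closed_terms" "x = closed_eq T `` {t}"
    unfolding init_algebra_carrier_iff by blast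
  then have "closed_eq T `` {Neg t} \<in> carrier (init_algebra T)"
      "closed_eq T `` {Inv t} \<in> carrier (init_algebra T)"
    by (simp_all add: init_algebra_class_in_carrier closed_terms_def)
  with t show "neg (init_algebra T) x \<in> carrier (init_algebra T)"
      "minv (init_algebra T) x \<in> carrier (init_algebra T)"
    by (simp_all add: init_algebra_Neg init_algebra_Inv)
qed

text \<open>
  The equation that separates the two sides is \<open>p \<cdot> p\<inverse> = 1\<close>: it is true in \<open>Q0\<close>, therefore
  provable, but false modulo \<open>p\<close>.
\<close>

lemma prime_field_not_models_if_isomorphic:
  assumes iso: "md_isomorphic Q0 (init_algebra (Md \<union> E))" and p: "prime p"
  shows "\<not> models (Zmod0 p) E"
proof
  assume E: "models (Zmod0 p) E"
  interpret P: residues_prime p "residue_ring (int p)"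
    using p by unfold_locales auto
  interpret Z: meadow "Zmod0 p" using p by (rule meadow_Zmod0)
  obtain h where h: "h \<in> md_iso Q0 (init_algebra (Md \<union> E))"
    using iso by (auto simp: md_isomorphic_def)
  define num where "num n = (Add One ^^ n) Zero" for n
  have num_closed: "num n \<in> closed_terms" for n
    by (induction n) (auto simp: num_def closed_terms_def)
  have num_Q: "md_eval Q0 v (num n) = of_nat n" for v n
    by (induction n) (simp_all add: num_def Q0_simps)
  have num_Z: "md_eval (Zmod0 p) v (num n) = int n mod int p" for v n
    by (induction n)
      (simp_all add: num_def Zmod0_def zero_totalized_def P.res_add_eq P.res_one_eq
        P.res_zero_eq mod_simps)
  let ?t = "Mul (num p) (Inv (num p))"
  have t: "?t \<in> closed_terms" "One \<in> closed_terms"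
    using num_closed[of p] by (simp_all add: closed_terms_def)
  have "md_eval Q0 (\<lambda>_. 0) ?t = md_eval Q0 (\<lambda>_. 0) One"
    using prime_gt_0_nat[OF p] by (simp add: num_Q Q0_simps)
  then have "h (md_eval Q0 (\<lambda>_. 0) ?t) = h (md_eval Q0 (\<lambda>_. 0) One)"
    by simp
  then have "md_eval (init_algebra (Md \<union> E)) (\<lambda>_. h 0) ?t
      = md_eval (init_algebra (Md \<union> E)) (\<lambda>_. h 0) One"
    by (simp only: md_iso_eval[OF meadow_Q0 h, of "\<lambda>_. 0"] Q0_simps UNIV_I)
  then have "provable (Md \<union> E) ?t One"
    by (simp only: init_algebra_eval_closed[OF t(1)] init_algebra_eval_closed[OF t(2)]
        init_algebra_class_eq_iff[OF t])
  moreover have "models (Zmod0 p) (Md \<union> E)"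
    using E Z.models_Md by (auto simp: models_def)
  ultimately have "md_eval (Zmod0 p) (\<lambda>_. \<zero>\<^bsub>Zmod0 p\<^esub>) ?t = md_eval (Zmod0 p) (\<lambda>_. \<zero>\<^bsub>Zmod0 p\<^esub>) One"
    by (intro Z.soundness) auto
  moreover have zero: "md_eval (Zmod0 p) v (num p) = \<zero>\<^bsub>Zmod0 p\<^esub>" for v
    unfolding num_Z by (simp add: Zmod0_def zero_totalized_def P.res_zero_eq)
  ultimately have "\<zero>\<^bsub>Zmod0 p\<^esub> = \<one>\<^bsub>Zmod0 p\<^esub>"
    by simp
  then show False
    using P.one_not_zero by (simp add: Zmod0_def zero_totalized_def)
qed

theorem theorem1:
  fixes E :: "md_eqn set"
  assumes "\<not> provable (Md \<union> E) Zero One"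
  shows "md_isomorphic Q0 (init_algebra (Md \<union> E)) \<longleftrightarrow>
    (\<forall>p::nat. prime p \<longrightarrow> \<not> models (Zmod0 p) E)"
proof (intro iffI allI impI)
  fix p :: nat
  assume "md_isomorphic Q0 (init_algebra (Md \<union> E))" "prime p"
  then show "\<not> models (Zmod0 p) E" by (rule prime_field_not_models_if_isomorphic)
next
  assume fails: "\<forall>p::nat. prime p \<longrightarrow> \<not> models (Zmod0 p) E"
  let ?I = "init_algebra (Md \<union> E)"
  interpret I: meadow ?I by (rule meadow_init_algebra) simp
  have "models ?I E"
    using init_algebra_models[of "Md \<union> E"] by (auto simp: models_def)
  then have "I.emb (int p) \<in> Units ?I" if "prime p" for p
    using I.prime_invertible[OF that] fails that by blast
  then have inv: "I.emb n \<in> Units ?I" if "n > 0" for n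
    using I.positive_invertible[of "nat n"] that by simp
  have "closed_eq (Md \<union> E) `` {Zero} \<noteq> closed_eq (Md \<union> E) `` {One}"
    using assms by (subst init_algebra_class_eq_iff) (simp_all add: closed_terms_def)
  then have "\<one>\<^bsub>?I\<^esub> \<noteq> \<zero>\<^bsub>?I\<^esub>"
    by (simp add: init_algebra_def)
  moreover have "\<exists>t. \<forall>v. md_eval ?I v t = x" if "x \<in> carrier ?I" for x
    using that init_algebra_eval_closed unfolding init_algebra_carrier_iff by metis
  ultimately show "md_isomorphic Q0 ?I"
    using inv by (intro I.Q0_isomorphic)
qed

end
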